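(* For all $n\in\mathbb{N}$ and all $\pi=\pi_1\pi_2\cdots\pi_n\in S_n$, \[\operatorname{sc}(\pi)=\max_{i\in[n]}\operatorname{sc}(\pi^i),\] where $\pi^i$ is the sequence obtained from $\pi_1\pi_2\cdots\pi_i$ by deleting every entry less than $\pi_i$ (equivalently, the subsequence of $\pi_1\cdots\pi_i$ consisting of entries $\ge \pi_i$).
   Context: A "permutation" here may be any finite sequence of distinct integers. West's stack-sorting map $s$ acts on such a sequence as follows: read the input from left to right with an initially empty stack; repeatedly, if the input is nonempty and either the stack is empty or the top element of the stack is greater than the next input entry, push the next input entry onto the stack; otherwise pop the top element of the stack and append it to the output; stop when both input and stack are empty. The output is $s(\pi)$. For a sequence $\pi$, $\operatorname{sc}(\pi)$ denotes the least integer $k\ge0$ such that $s^k(\pi)$ is increasing. $S_n$ is the set of permutations of $[n]=\{1,\dots,n\}$, written in one-line notation. *)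

theory Defs
  imports "HOL-Combinatorics.Multiset_Permutations"
begin

text \<open>
  \<open>stack_run xs st\<close> is the output still to be produced when the remaining input is \<open>xs\<close> and the
  stack contents are \<open>st\<close>, with the top of the stack at the head of the list.
\<close>
function stack_run :: "int list \<Rightarrow> int list \<Rightarrow> int list" where
  "stack_run [] [] = []"
| "stack_run (x # xs) [] = stack_run xs [x]"
| "stack_run (x # xs) (t # st) =
     (if t > x then stack_run xs (x # t # st) else t # stack_run (x # xs) st)"
| "stack_run [] (t # st) = t # stack_run [] st"
  by pat_completeness auto
termination
  by (relation "measure (\<lambda>(xs, st). 2 * length xs + length st)") auto

definition stack_sort :: "int list \<Rightarrow> int list" where
  "stack_sort xs = stack_run xs []"

definition sc :: "int list \<Rightarrow> nat" where
  "sc xs = (LEAST k. sorted_wrt (<) ((stack_sort ^^ k) xs))"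

text \<open>The index \<open>i\<close> is 1-based: \<open>xs ! (i - 1)\<close> is the \<open>i\<close>-th entry.\<close>
definition prefix_ge :: "int list \<Rightarrow> nat \<Rightarrow> int list" where
  "prefix_ge xs i = filter (\<lambda>x. \<not> x < xs ! (i - 1)) (take i xs)"

end

theory Submission
  imports Defs
begin

text \<open>
  For an entry \<open>a\<close> of a sequence, look at the word \<open>A\<close> of the entries greater than \<open>a\<close> that
  precede \<open>a\<close>. When \<open>a\<close> is pushed, no entry greater than \<open>a\<close> is popped, and \<open>a\<close> itself leaves the
  stack before any of those that are still there. Hence after one pass the corresponding word is
  the one popped while \<open>A\<close> alone is read: it depends on \<open>A\<close> only. A sequence is increasing iff all
  these words are empty, so the number of passes needed is determined by the words of its entries.
  The entries of \<open>\<pi>\<^sup>i\<close> have the same words in \<open>\<pi>\<^sup>i\<close> as in \<open>\<pi>\<close>, and every entry of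
  \<open>\<pi>\<close> occurs in some \<open>\<pi>\<^sup>i\<close>.
\<close>

definition greater_before :: "int \<Rightarrow> int list \<Rightarrow> int list" where
  "greater_before a xs = filter (\<lambda>x. a < x) (takeWhile (\<lambda>x. x \<noteq> a) xs)"

text \<open>Unlike \<open>stack_run\<close>, the stack is not emptied once the input is exhausted.\<close>
function popped :: "int list \<Rightarrow> int list \<Rightarrow> int list" where
  "popped [] st = []"
| "popped (x # xs) [] = popped xs [x]"
| "popped (x # xs) (t # st) =
     (if t > x then popped xs (x # t # st) else t # popped (x # xs) st)"
  by pat_completeness auto
termination
  by (relation "measure (\<lambda>(xs, st). 2 * length xs + length st)") auto

lemma mset_stack_run: "mset (stack_run xs st) = mset xs + mset st"
  by (induction xs st rule: stack_run.induct) auto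

lemma mset_stack_sort_funpow: "mset ((stack_sort ^^ k) xs) = mset xs"
  by (induction k) (auto simp: stack_sort_def mset_stack_run)

text \<open>A new entry is pushed only below the value of the current top. While \<open>a\<close> is
  stacked with nothing greater above it, that top is at most \<open>a\<close>, so nothing greater
  can get above \<open>a\<close> before it is popped.\<close>

lemma greater_before_stack_run_stacked:
  "a \<in> set st \<Longrightarrow> greater_before a st = [] \<Longrightarrow> greater_before a (stack_run xs st) = []"
  by (induction xs st rule: stack_run.induct) (auto simp: greater_before_def split: if_splits)

text \<open>Until \<open>a\<close> is pushed, each step either restricts to the same step on the
  entries greater than \<open>a\<close> or leaves them untouched: a top greater than
  \<open>a\<close> is popped only by an entry at least as large. The stack is arbitrary for the sake
  of the induction.\<close>

lemma greater_before_stack_run: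
  assumes "a \<in> set xs" "a \<notin> set st"
  shows "greater_before a (stack_run xs st) =
           popped (greater_before a xs) (filter (\<lambda>x. a < x) st)"
  using assms
proof (induction xs st rule: stack_run.induct)
  case (2 x xs)
  then show ?case
    using greater_before_stack_run_stacked[of a "[a]" xs]
    by (cases "x = a") (auto simp: greater_before_def)
next
  case (3 x xs t st)
  show ?case
  proof (cases "t > x")
    case True
    with 3 show ?thesis
      using greater_before_stack_run_stacked[of a "a # t # st" xs]
      by (cases "x = a") (auto simp: greater_before_def)
  next
    case False
    with 3 show ?thesis
      by (cases "x = a") (auto simp: greater_before_def)
  qed
qed auto

lemma greater_before_stack_sort_funpow:
  assumes "a \<in> set xs"
  shows "greater_before a ((stack_sort ^^ k) xs) =
           ((\<lambda>ys. popped ys []) ^^ k) (greater_before a xs)"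
proof (induction k)
  case (Suc k)
  have "a \<in> set ((stack_sort ^^ k) xs)"
    using assms mset_eq_setD[OF mset_stack_sort_funpow] by blast
  with Suc show ?case
    by (simp add: stack_sort_def[of "(stack_sort ^^ k) xs"] greater_before_stack_run)
qed simp

text \<open>Whatever is not popped remains on the stack, and the last input entry is never popped.
  So repeated passes exhaust every word.\<close>

lemma length_popped_less:
  "xs \<noteq> [] \<or> st \<noteq> [] \<Longrightarrow> length (popped xs st) < length xs + length st"
  by (induction xs st rule: popped.induct) auto

lemma popped_funpow_eq_Nil:
  "length xs \<le> k \<Longrightarrow> ((\<lambda>ys. popped ys []) ^^ k) xs = []"
proof (induction k arbitrary: xs)
  case (Suc k)
  have "length (popped xs []) \<le> k"
    using length_popped_less[of xs "[]"] Suc.prems by (cases "xs = []") auto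
  with Suc.IH show ?case by (simp add: funpow_Suc_right del: funpow.simps)
qed simp

lemma sorted_wrt_less_iff_greater_before:
  assumes "distinct xs"
  shows "sorted_wrt (<) xs \<longleftrightarrow> (\<forall>a\<in>set xs. greater_before a xs = [])"
  using assms
proof (induction xs)
  case (Cons x xs)
  have "greater_before x (x # xs) = []"
    by (simp add: greater_before_def)
  moreover have "greater_before a (x # xs) = [] \<longleftrightarrow> x < a \<and> greater_before a xs = []"
    if "a \<in> set xs" for a
    using that Cons.prems by (auto simp: greater_before_def)
  ultimately show ?case
    using Cons by auto
qed simp

lemma sorted_stack_sort_funpow_iff:
  assumes "distinct xs"
  shows "sorted_wrt (<) ((stack_sort ^^ k) xs) \<longleftrightarrow>
           (\<forall>a\<in>set xs. ((\<lambda>ys. popped ys []) ^^ k) (greater_before a xs) = [])"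
proof -
  have "distinct ((stack_sort ^^ k) xs)"
    using assms mset_eq_imp_distinct_iff[OF mset_stack_sort_funpow] by blast
  moreover have "set ((stack_sort ^^ k) xs) = set xs"
    by (rule mset_eq_setD[OF mset_stack_sort_funpow])
  ultimately show ?thesis
    by (simp add: sorted_wrt_less_iff_greater_before greater_before_stack_sort_funpow)
qed

lemma sc_le_iff:
  assumes "distinct xs"
  shows "sc xs \<le> k \<longleftrightarrow>
           (\<forall>a\<in>set xs. ((\<lambda>ys. popped ys []) ^^ k) (greater_before a xs) = [])"
    (is "_ \<longleftrightarrow> ?P k")
proof -
  have sc: "sc xs = (LEAST k. ?P k)"
    by (simp add: sc_def sorted_stack_sort_funpow_iff[OF assms])
  have "length (greater_before a xs) \<le> length xs" for a
    unfolding greater_before_def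
    using length_filter_le length_takeWhile_le le_trans by blast
  \<comment> \<open>Some \<open>k\<close> must satisfy \<open>?P\<close> before \<open>LEAST\<close>
    can be trusted.\<close>
  then have "?P (length xs)"
    by (simp add: popped_funpow_eq_Nil)
  then have P: "?P (sc xs)"
    unfolding sc by (rule LeastI)
  \<comment> \<open>An empty word stays empty, so \<open>?P\<close> is upward closed.\<close>
  have "?P (j + sc xs)" for j
    using P by (simp add: funpow_add popped_funpow_eq_Nil)
  then have "?P k" if "sc xs \<le> k"
    using that by (metis le_add_diff_inverse2)
  moreover have "sc xs \<le> k" if "?P k"
    unfolding sc using that by (rule Least_le)
  ultimately show ?thesis by blast
qed

lemma takeWhile_filter_neq:
  "P b \<Longrightarrow> takeWhile (\<lambda>x. x \<noteq> b) (filter P xs) = filter P (takeWhile (\<lambda>x. x \<noteq> b) xs)"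
  by (induction xs) auto

text \<open>Deleted entries are less than \<open>xs ! (i - 1)\<close>, hence less than
  \<open>b\<close>, and the entries cut off come after the first \<open>b\<close>.\<close>

lemma greater_before_prefix_ge:
  assumes "b \<in> set (prefix_ge xs i)"
  shows "greater_before b (prefix_ge xs i) = greater_before b xs"
proof -
  let ?c = "xs ! (i - 1)"
  have b: "\<not> b < ?c" "b \<in> set (take i xs)"
    using assms by (auto simp: prefix_ge_def)
  have "takeWhile (\<lambda>x. x \<noteq> b) (take i xs @ drop i xs) = takeWhile (\<lambda>x. x \<noteq> b) (take i xs)"
    using b(2) by (intro takeWhile_append1) auto
  then have "takeWhile (\<lambda>x. x \<noteq> b) (take i xs) = takeWhile (\<lambda>x. x \<noteq> b) xs"
    by simp
  then show ?thesis
    using b(1)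
    by (auto simp: greater_before_def prefix_ge_def takeWhile_filter_neq intro!: filter_cong)
qed

lemma nth_mem_prefix_ge:
  assumes "j < length xs"
  shows "xs ! j \<in> set (prefix_ge xs (Suc j))"
  using assms by (simp add: prefix_ge_def take_Suc_conv_app_nth)

lemma sc_le_iff_prefix_ge:
  assumes "distinct xs"
  shows "sc xs \<le> k \<longleftrightarrow> (\<forall>i\<in>{1..length xs}. sc (prefix_ge xs i) \<le> k)"
proof -
  let ?Q = "\<lambda>a. ((\<lambda>ys. popped ys []) ^^ k) (greater_before a xs) = []"
  have "distinct (prefix_ge xs i)" for i
    using assms by (simp add: prefix_ge_def)
  then have prefix: "sc (prefix_ge xs i) \<le> k \<longleftrightarrow> (\<forall>a\<in>set (prefix_ge xs i). ?Q a)" for i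
    by (simp add: sc_le_iff greater_before_prefix_ge)
  have "set (prefix_ge xs i) \<subseteq> set xs" for i
    using set_take_subset by (fastforce simp: prefix_ge_def)
  moreover have "\<exists>i\<in>{1..length xs}. a \<in> set (prefix_ge xs i)" if a: "a \<in> set xs" for a
  proof -
    obtain j where "j < length xs" "a = xs ! j"
      using a by (metis in_set_conv_nth)
    then show ?thesis
      using nth_mem_prefix_ge[of j xs] by (intro bexI[of _ "Suc j"]) auto
  qed
  ultimately show ?thesis
    unfolding sc_le_iff[OF assms] prefix by blast
qed

theorem theorem1p5:
  fixes n :: nat and \<pi> :: "int list"
  assumes "n \<ge> 1"
    and "\<pi> \<in> permutations_of_set {1..int n}"
  shows "sc \<pi> = Max ((\<lambda>i. sc (prefix_ge \<pi> i)) ` {1..n})"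
proof -
  have "distinct \<pi>" and "length \<pi> = n"
    using assms(2) length_finite_permutations_of_set[OF assms(2)]
    by (auto simp: permutations_of_set_def)
  then have le_iff: "sc \<pi> \<le> k \<longleftrightarrow> (\<forall>i\<in>{1..n}. sc (prefix_ge \<pi> i) \<le> k)" for k
    using sc_le_iff_prefix_ge by blast
  show ?thesis
  proof (rule antisym)
    show "sc \<pi> \<le> Max ((\<lambda>i. sc (prefix_ge \<pi> i)) ` {1..n})"
      unfolding le_iff by simp
    \<comment> \<open>Here \<open>n \<ge> 1\<close> makes the image nonempty, as
      \<open>Max_le_iff\<close> requires.\<close>
    show "Max ((\<lambda>i. sc (prefix_ge \<pi> i)) ` {1..n}) \<le> sc \<pi>"
      using assms(1) le_iff[of "sc \<pi>"] by (subst Max_le_iff) auto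
  qed
qed

end
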